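(* Let $X$ and $Y$ be two strictly convex real Banach spaces and let $Z=X\oplus_\infty Y$. Then the closed unit ball $B_Z=\{z\in Z:\|z\|\le 1\}$, with the metric induced by the norm of $Z$, is a plastic metric space; that is, every non-expansive bijection $F\colon B_Z\to B_Z$ is an isometry.
   Context: All Banach spaces are real. A Banach space $X$ is strictly convex if every point of its unit sphere $S_X=\{x\in X:\|x\|=1\}$ is an extreme point of its closed unit ball $B_X=\{x\in X:\|x\|\le 1\}$, i.e. does not belong to the interior of any non-trivial line segment connecting two distinct points of $B_X$. The space $X\oplus_\infty Y$ is the vector space $X\times Y$ with the norm $\|(x,y)\|=\max\{\|x\|,\|y\|\}$. A function $F$ between metric spaces is called non-expansive if $d(F(u),F(v))\le d(u,v)$ for all $u,v$, and an isometry if $d(F(u),F(v))=d(u,v)$ for all $u,v$. A metric space $M$ is called plastic if every non-expansive bijection from $M$ onto itself is an isometry. *)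

theory Defs
  imports "HOL-Analysis.Analysis"
begin

definition strictly_convex :: "'a::real_normed_vector itself \<Rightarrow> bool" where
  "strictly_convex TYPE('a) \<longleftrightarrow>
     (\<forall>x\<in>sphere (0::'a) 1. x extreme_point_of cball 0 1)"

definition non_expansive_on :: "'a::metric_space set \<Rightarrow> ('a \<Rightarrow> 'b::metric_space) \<Rightarrow> bool" where
  "non_expansive_on M F \<longleftrightarrow> (\<forall>u\<in>M. \<forall>v\<in>M. dist (F u) (F v) \<le> dist u v)"

definition isometry_on :: "'a::metric_space set \<Rightarrow> ('a \<Rightarrow> 'b::metric_space) \<Rightarrow> bool" where
  "isometry_on M F \<longleftrightarrow> (\<forall>u\<in>M. \<forall>v\<in>M. dist (F u) (F v) = dist u v)"

text \<open>The metric space in question is the set \<open>M\<close> with the metric it inherits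
  from the ambient type.\<close>

definition plastic :: "'a::metric_space set \<Rightarrow> bool" where
  "plastic M \<longleftrightarrow> (\<forall>F. bij_betw F M M \<longrightarrow> non_expansive_on M F \<longrightarrow> isometry_on M F)"

text \<open>The library's product type carries the Euclidean combination of the two norms, so
  \<open>X \<oplus> Y\<close> with the maximum norm needs a type of its own.\<close>

datatype ('a, 'b) linf_sum = Linf (linf_fst: 'a) (linf_snd: 'b)

instantiation linf_sum :: (real_vector, real_vector) real_vector
begin

definition "0 = Linf 0 0"
definition "z + w = Linf (linf_fst z + linf_fst w) (linf_snd z + linf_snd w)"
definition "z - w = Linf (linf_fst z - linf_fst w) (linf_snd z - linf_snd w)"
definition "- z = Linf (- linf_fst z) (- linf_snd z)"
definition "c *\<^sub>R z = Linf (c *\<^sub>R linf_fst z) (c *\<^sub>R linf_snd z)"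

instance
  by standard
    (simp_all add: zero_linf_sum_def plus_linf_sum_def minus_linf_sum_def uminus_linf_sum_def
      scaleR_linf_sum_def algebra_simps)

end

lemma linf_simps [simp]:
  "linf_fst 0 = 0" "linf_snd 0 = 0"
  "linf_fst (z + w) = linf_fst z + linf_fst w" "linf_snd (z + w) = linf_snd z + linf_snd w"
  "linf_fst (z - w) = linf_fst z - linf_fst w" "linf_snd (z - w) = linf_snd z - linf_snd w"
  "linf_fst (- z) = - linf_fst z" "linf_snd (- z) = - linf_snd z"
  "linf_fst (c *\<^sub>R z) = c *\<^sub>R linf_fst z" "linf_snd (c *\<^sub>R z) = c *\<^sub>R linf_snd z"
  by (simp_all add: zero_linf_sum_def plus_linf_sum_def minus_linf_sum_def uminus_linf_sum_def
      scaleR_linf_sum_def)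

instantiation linf_sum :: (real_normed_vector, real_normed_vector) real_normed_vector
begin

definition "norm z = max (norm (linf_fst z)) (norm (linf_snd z))"

definition "dist z w = norm (z - w :: ('a, 'b) linf_sum)"

definition "sgn z = inverse (norm z) *\<^sub>R (z :: ('a, 'b) linf_sum)"

definition [code del]:
  "(uniformity :: (('a, 'b) linf_sum \<times> ('a, 'b) linf_sum) filter) =
     (INF e\<in>{0<..}. principal {(z, w). dist z w < e})"

definition [code del]:
  "open (U :: ('a, 'b) linf_sum set) \<longleftrightarrow>
     (\<forall>z\<in>U. eventually (\<lambda>(z', w). z' = z \<longrightarrow> w \<in> U) uniformity)"

instance
proof
  fix r :: real and z w :: "('a, 'b) linf_sum" and U :: "('a, 'b) linf_sum set"
  show "dist z w = norm (z - w)"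
    by (rule dist_linf_sum_def)
  show "sgn z = inverse (norm z) *\<^sub>R z"
    by (rule sgn_linf_sum_def)
  show "uniformity = (INF e\<in>{0<..}. principal {(z, w :: ('a, 'b) linf_sum). dist z w < e})"
    by (rule uniformity_linf_sum_def)
  show "open U \<longleftrightarrow> (\<forall>z\<in>U. eventually (\<lambda>(z', w). z' = z \<longrightarrow> w \<in> U) uniformity)"
    by (rule open_linf_sum_def)
  have "norm z = 0 \<longleftrightarrow> norm (linf_fst z) = 0 \<and> norm (linf_snd z) = 0"
    unfolding norm_linf_sum_def
    using norm_ge_zero[of "linf_fst z"] norm_ge_zero[of "linf_snd z"] by linarith
  then show "norm z = 0 \<longleftrightarrow> z = 0"
    by (cases z) (simp add: zero_linf_sum_def)
  show "norm (z + w) \<le> norm z + norm w"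
    unfolding norm_linf_sum_def
    using norm_triangle_ineq[of "linf_fst z" "linf_fst w"]
      norm_triangle_ineq[of "linf_snd z" "linf_snd w"]
    unfolding linf_simps by linarith
  show "norm (r *\<^sub>R z) = \<bar>r\<bar> * norm z"
    unfolding norm_linf_sum_def linf_simps norm_scaleR
    by (rule max_of_mono) (simp add: mono_def mult_left_mono)
qed

end

instance linf_sum :: (banach, banach) banach
proof
  fix S :: "nat \<Rightarrow> ('a, 'b) linf_sum"
  assume S: "Cauchy S"
  have "Cauchy (\<lambda>n. linf_fst (S n))"
  proof (rule metric_CauchyI)
    fix e :: real assume "e > 0"
    then obtain M where M: "\<And>m n. m \<ge> M \<Longrightarrow> n \<ge> M \<Longrightarrow> dist (S m) (S n) < e"
      using metric_CauchyD[OF S] by blast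
    show "\<exists>M. \<forall>m\<ge>M. \<forall>n\<ge>M. dist (linf_fst (S m)) (linf_fst (S n)) < e"
    proof (intro exI allI impI)
      fix m n assume "m \<ge> M" "n \<ge> M"
      from M[OF this] show "dist (linf_fst (S m)) (linf_fst (S n)) < e"
        by (simp add: dist_norm norm_linf_sum_def)
    qed
  qed
  moreover have "Cauchy (\<lambda>n. linf_snd (S n))"
  proof (rule metric_CauchyI)
    fix e :: real assume "e > 0"
    then obtain M where M: "\<And>m n. m \<ge> M \<Longrightarrow> n \<ge> M \<Longrightarrow> dist (S m) (S n) < e"
      using metric_CauchyD[OF S] by blast
    show "\<exists>M. \<forall>m\<ge>M. \<forall>n\<ge>M. dist (linf_snd (S m)) (linf_snd (S n)) < e"
    proof (intro exI allI impI)
      fix m n assume "m \<ge> M" "n \<ge> M"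
      from M[OF this] show "dist (linf_snd (S m)) (linf_snd (S n)) < e"
        by (simp add: dist_norm norm_linf_sum_def)
    qed
  qed
  ultimately obtain x y where xy: "(\<lambda>n. linf_fst (S n)) \<longlonglongrightarrow> x" "(\<lambda>n. linf_snd (S n)) \<longlonglongrightarrow> y"
    unfolding Cauchy_convergent_iff convergent_def by blast
  have "(\<lambda>n. max (norm (linf_fst (S n) - x)) (norm (linf_snd (S n) - y))) \<longlonglongrightarrow> max 0 0"
    by (rule tendsto_max[OF tendsto_norm_zero[OF LIM_zero[OF xy(1)]]
          tendsto_norm_zero[OF LIM_zero[OF xy(2)]]])
  then have "(\<lambda>n. norm (S n - Linf x y)) \<longlonglongrightarrow> 0"
    by (simp add: norm_linf_sum_def)
  then show "convergent S"
    by (rule convergentI[OF LIM_zero_cancel[OF tendsto_norm_zero_cancel]])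
qed

end

theory Submission
  imports Defs
begin

text \<open>Call a corner a pair of unit vectors \<open>(x, y)\<close>, and let \<open>G\<close> be the inverse of \<open>F\<close>. Corners are the
  extreme points of the ball, which forces \<open>F (t G e) = t e\<close> for a corner \<open>e\<close>. As \<open>G\<close> expands
  distances, corners at distance 2 go to points at distance 2; with strict convexity this shows
  that, up to exchanging the two factors, \<open>G (x, y) = (p x, q y)\<close> on corners. If some corner were
  not of the form \<open>(p x, q y)\<close>, the complement of the cone over these points would be connected,
  whereas its image under \<open>F\<close>, the set of \<open>(x, y)\<close> with \<open>\<parallel>x\<parallel> \<noteq> \<parallel>y\<parallel>\<close>, is not. So \<open>p\<close> and \<open>q\<close> are
  onto, and then \<open>F (a p x, b q y) = (a x, b y)\<close> for all \<open>a\<close> and \<open>b\<close> in \<open>[0, 1]\<close>. It remains to see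
  that a non-expansive, norm-preserving homogeneous map \<open>f\<close> is an isometry. This follows from
  \<open>\<parallel>f a - f b\<parallel> \<ge> 2 \<parallel>w\<parallel> - \<parallel>w - a\<parallel> - \<parallel>w + b\<parallel>\<close>, because the supremum over \<open>w\<close> of the right-hand side
  is \<open>\<parallel>a - b\<parallel>\<close>. If a factor is trivial, every unit vector of the sum is extreme and the first
  and last steps suffice.\<close>

section \<open>Rigid unit vectors\<close>

text \<open>Extremality with the convex weights cleared of denominators. In this form it applies
  whenever distances \<open>s\<close> and \<open>t\<close> to two known points add up to the
  distance between them, and it pins down the point in between.\<close>

definition rigid :: "'a::real_normed_vector \<Rightarrow> bool" where
  "rigid e \<longleftrightarrow> (\<forall>c d s t. 0 \<le> s \<longrightarrow> 0 \<le> t \<longrightarrow> norm c \<le> s \<longrightarrow> norm d \<le> t \<longrightarrow>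
     c + d = (s + t) *\<^sub>R e \<longrightarrow> d = t *\<^sub>R e)"

lemma rigidD:
  assumes "rigid e" "norm c \<le> s" "norm d \<le> t" "c + d = (s + t) *\<^sub>R e"
  shows "d = t *\<^sub>R e"
proof -
  have "0 \<le> s" "0 \<le> t"
    using assms(2,3) norm_ge_zero order_trans by blast+
  then show ?thesis
    using assms unfolding rigid_def by blast
qed

lemma rigid_minus:
  assumes "rigid e"
  shows "rigid (- e)"
  unfolding rigid_def
proof (intro allI impI)
  fix c d :: 'a and s t :: real
  assume n: "norm c \<le> s" "norm d \<le> t" and sum: "c + d = (s + t) *\<^sub>R - e"
  have "- c + - d = (s + t) *\<^sub>R e"
    using arg_cong[OF sum, of uminus] by (simp only: scaleR_minus_right minus_minus minus_add_distrib)
  then have "- d = t *\<^sub>R e"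
    using n rigidD[OF assms, of "- c" s "- d" t] by simp
  then show "d = t *\<^sub>R - e"
    by (metis minus_minus scaleR_minus_right)
qed

text \<open>Serves the degenerate case of the theorem, where the coordinate in a trivial factor is
  zero instead of a unit vector.\<close>

lemma rigid_if_trivial:
  assumes "\<And>u::'a::real_normed_vector. u = 0"
  shows "rigid (e::'a)"
  unfolding rigid_def
proof (intro allI impI)
  fix d :: 'a and t :: real
  show "d = t *\<^sub>R e"
    using assms[of d] assms[of "t *\<^sub>R e"] by simp
qed

text \<open>Dividing \<open>c\<close> by \<open>s\<close> and \<open>d\<close> by \<open>t\<close>
  exhibits \<open>e\<close> as a proper convex combination of two points of the ball, which
  extremality forces to coincide.\<close>

lemma rigid_extreme_point:
  assumes "e extreme_point_of cball (0::'a::real_normed_vector) 1"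
  shows "rigid e"
  unfolding rigid_def
proof (intro allI impI)
  fix c d :: 'a and s t :: real
  assume st: "0 \<le> s" "0 \<le> t" and n: "norm c \<le> s" "norm d \<le> t" and sum: "c + d = (s + t) *\<^sub>R e"
  show "d = t *\<^sub>R e"
  proof (cases "s = 0 \<or> t = 0")
    case True
    then show ?thesis using n sum by auto
  next
    case False
    then have pos: "s > 0" "t > 0" using st by auto
    define c' d' where "c' = c /\<^sub>R s" and "d' = d /\<^sub>R t"
    have cd: "c = s *\<^sub>R c'" "d = t *\<^sub>R d'"
      using pos by (simp_all add: c'_def d'_def)
    have in_ball: "c' \<in> cball 0 1" "d' \<in> cball 0 1"
      using n pos by (simp_all add: c'_def d'_def field_simps)
    have "(s + t) *\<^sub>R e = (s + t) *\<^sub>R ((1 - t / (s + t)) *\<^sub>R c' + (t / (s + t)) *\<^sub>R d')"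
    proof -
      have "(s + t) * (1 - t / (s + t)) = s" "(s + t) * (t / (s + t)) = t"
        using pos by (simp_all add: field_simps)
      then show ?thesis
        using sum unfolding cd scaleR_right_distrib scaleR_scaleR by metis
    qed
    then have e: "e = (1 - t / (s + t)) *\<^sub>R c' + (t / (s + t)) *\<^sub>R d'"
      using pos by simp
    have "c' = d'"
    proof (rule ccontr)
      assume "c' \<noteq> d'"
      then have "e \<in> open_segment c' d'"
        unfolding in_segment using e pos
        by (intro conjI exI[of _ "t / (s + t)"]) (simp_all add: field_simps)
      then show False
        using assms in_ball unfolding extreme_point_of_def by blast
    qed
    then have "e = d'"
      using e by (simp flip: scaleR_left_distrib)
    then show ?thesis using cd by simp
  qed
qed

lemma strictly_convex_rigid:
  assumes "strictly_convex TYPE('a::real_normed_vector)" "norm (e::'a) = 1"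
  shows "rigid e"
  by (rule rigid_extreme_point) (use assms in \<open>simp add: strictly_convex_def\<close>)

text \<open>The maximum norm bounds both coordinates by the same radius, so the condition splits
  coordinatewise.\<close>

lemma rigid_Linf:
  assumes "rigid x" "rigid y"
  shows "rigid (Linf x y)"
  unfolding rigid_def
proof (intro allI impI)
  fix c d :: "('a, 'b) linf_sum" and s t :: real
  assume n: "norm c \<le> s" "norm d \<le> t" and sum: "c + d = (s + t) *\<^sub>R Linf x y"
  have "linf_fst d = t *\<^sub>R x"
    using n arg_cong[OF sum, of linf_fst] rigidD[OF assms(1), of "linf_fst c" s "linf_fst d" t]
    by (simp add: norm_linf_sum_def)
  moreover have "linf_snd d = t *\<^sub>R y"
    using n arg_cong[OF sum, of linf_snd] rigidD[OF assms(2), of "linf_snd c" s "linf_snd d" t]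
    by (simp add: norm_linf_sum_def)
  ultimately show "d = t *\<^sub>R Linf x y"
    by (simp add: linf_sum.expand)
qed

text \<open>The midpoint of \<open>u\<close> and \<open>v\<close> is a unit vector, hence rigid, and
  \<open>u + v\<close> splits its double with radii 1 and 1.\<close>

lemma eq_if_norm_add_eq_2:
  fixes u v :: "'a::real_normed_vector"
  assumes "\<And>e::'a. norm e = 1 \<Longrightarrow> rigid e"
    and "norm u \<le> 1" "norm v \<le> 1" "norm (u + v) \<ge> 2"
  shows "u = v"
proof -
  define m where "m = (1/2) *\<^sub>R (u + v)"
  have uv: "u + v = (1 + 1) *\<^sub>R m" by (simp add: m_def)
  have "norm (u + v) = 2"
    using assms norm_triangle_ineq[of u v] by linarith
  then have "rigid m"
    by (intro assms(1)) (simp add: m_def)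
  from rigidD[OF this assms(2,3) uv] uv show ?thesis
    by (simp add: scaleR_2)
qed

lemma norm_Linf [simp]: "norm (Linf x y) = max (norm x) (norm y)"
  by (simp add: norm_linf_sum_def)

lemma scaleR_Linf: "c *\<^sub>R Linf x y = Linf (c *\<^sub>R x) (c *\<^sub>R y)"
  by (simp add: scaleR_linf_sum_def)

lemma uminus_Linf: "- Linf x y = Linf (- x) (- y)"
  by (simp add: uminus_linf_sum_def)

lemma minus_Linf: "Linf x y - Linf x' y' = Linf (x - x') (y - y')"
  by (simp add: minus_linf_sum_def)

section \<open>Homogeneous non-expansive maps\<close>

text \<open>The point \<open>j c + i e\<close> is compared with its two predecessors \<open>(j - 1) c + (i \<mp> 1) e\<close>, as
  for a simple random walk of \<open>j\<close> steps; the square root is its standard deviation.\<close>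

lemma norm_walk_le:
  fixes c e :: "'a::real_normed_vector"
  assumes step: "\<And>w. 2 * norm w \<le> d + norm (w - (c + e)) + norm (w - (c - e))"
  shows "norm (real j *\<^sub>R c + i *\<^sub>R e) \<le> real j * d / 2 + norm e * sqrt (real j + i\<^sup>2)"
proof (induction j arbitrary: i)
  case 0
  then show ?case by simp
next
  case (Suc j)
  let ?w = "real (Suc j) *\<^sub>R c + i *\<^sub>R e"
  let ?r = "sqrt (real j + (i - 1)\<^sup>2)" and ?s = "sqrt (real j + (i + 1)\<^sup>2)"
  have 1: "?w - (c + e) = real j *\<^sub>R c + (i - 1) *\<^sub>R e"
    by (simp add: algebra_simps)
  have 2: "?w - (c - e) = real j *\<^sub>R c + (i + 1) *\<^sub>R e"
    by (simp add: algebra_simps)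
  \<comment> \<open>The mean of two square roots is at most the root of the mean of the radicands,
    here \<open>real (Suc j) + i\<^sup>2\<close>.\<close>
  have "(?r + ?s) / 2 \<le> sqrt (real (Suc j) + i\<^sup>2)"
  proof (rule real_le_rsqrt)
    have sq: "?r\<^sup>2 = real j + (i - 1)\<^sup>2" "?s\<^sup>2 = real j + (i + 1)\<^sup>2"
      by (simp_all only: real_sqrt_pow2_iff) simp_all
    have "0 \<le> (?r - ?s)\<^sup>2" by simp
    then have "(?r + ?s)\<^sup>2 \<le> 2 * (?r\<^sup>2 + ?s\<^sup>2)"
      by (simp add: power2_eq_square algebra_simps)
    also have "\<dots> = 4 * (real (Suc j) + i\<^sup>2)"
      unfolding sq by (simp add: power2_eq_square algebra_simps)
    finally show "((?r + ?s) / 2)\<^sup>2 \<le> real (Suc j) + i\<^sup>2"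
      by (simp add: power_divide)
  qed
  then have "norm e * ((?r + ?s) / 2) \<le> norm e * sqrt (real (Suc j) + i\<^sup>2)"
    by (rule mult_left_mono) simp
  moreover have "2 * norm ?w \<le> d + (real j * d / 2 + norm e * ?r) + (real j * d / 2 + norm e * ?s)"
    using step[of ?w] Suc.IH[of "i - 1"] Suc.IH[of "i + 1"] unfolding 1 2 by linarith
  ultimately show ?case
    by (simp add: algebra_simps add_divide_distrib)
qed

text \<open>Along the multiples \<open>j c\<close> the norm grows linearly while the error of the
  walk is only of order \<open>sqrt j\<close>; dividing by \<open>j\<close> leaves
  \<open>norm c \<le> d / 2\<close>.\<close>

lemma norm_diff_le_if_walk:
  fixes a b :: "'a::real_normed_vector"
  assumes "\<And>w. 2 * norm w \<le> d + norm (w - a) + norm (w + b)"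
  shows "norm (a - b) \<le> d"
proof (rule ccontr)
  assume "\<not> norm (a - b) \<le> d"
  \<comment> \<open>With this choice \<open>a = c + e\<close> and \<open>- b = c - e\<close> are the
    two steps of the walk.\<close>
  define c e where "c = (1/2) *\<^sub>R (a - b)" and "e = (1/2) *\<^sub>R (a + b)"
  have ab: "a = c + e" "b = e - c"
    by (simp_all add: c_def e_def algebra_simps flip: scaleR_2 scaleR_left_distrib)
  define g where "g = norm c - d / 2"
  have g: "g > 0"
    using \<open>\<not> norm (a - b) \<le> d\<close> by (simp add: g_def c_def)
  have bound: "real j * g \<le> norm e * sqrt (real j)" for j
    using norm_walk_le[of d c e j 0] assms unfolding ab g_def
    by (simp add: algebra_simps)
  obtain j :: nat where j: "real j > (norm e / g)\<^sup>2"
    using reals_Archimedean2 by blast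
  then have j0: "sqrt (real j) > 0"
    by (metis le_less_trans real_sqrt_gt_zero zero_le_power2)
  have "sqrt (real j) > norm e / g"
    using j by (rule real_less_rsqrt)
  then have "norm e < sqrt (real j) * g"
    using g by (simp add: pos_divide_less_eq)
  then have "norm e * sqrt (real j) < sqrt (real j) * g * sqrt (real j)"
    using j0 by (rule mult_strict_right_mono)
  also have "\<dots> = (sqrt (real j) * sqrt (real j)) * g"
    by (simp only: ac_simps)
  finally show False
    using bound[of j] by simp
qed

lemma isometry_on_ball_if_homogeneous:
  fixes f :: "'a::real_normed_vector \<Rightarrow> 'b::real_normed_vector"
  assumes nonexp: "non_expansive_on (cball 0 1) f"
    and hom: "\<And>u t. norm u \<le> 1 \<Longrightarrow> \<bar>t\<bar> \<le> 1 \<Longrightarrow> f (t *\<^sub>R u) = t *\<^sub>R f u"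
    and norm_f: "\<And>u. norm u \<le> 1 \<Longrightarrow> norm (f u) = norm u"
  shows "isometry_on (cball 0 1) f"
  unfolding isometry_on_def
proof (intro ballI antisym)
  fix a b :: 'a
  assume "a \<in> cball 0 1" "b \<in> cball 0 1"
  then have ab: "norm a \<le> 1" "norm b \<le> 1" by auto
  show "dist (f a) (f b) \<le> dist a b"
    using nonexp ab unfolding non_expansive_on_def by auto
  have lip: "norm (f u - f v) \<le> norm (u - v)" if "norm u \<le> 1" "norm v \<le> 1" for u v
    using nonexp that unfolding non_expansive_on_def by (auto simp: dist_norm)
  have small: "2 * norm w \<le> norm (f u - f v) + norm (w - u) + norm (w + v)"
    if n: "norm w \<le> 1" "norm u \<le> 1" "norm v \<le> 1" for u v w
  proof -
    have "f (- v) = - f v"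
      using hom[of v "-1"] n by simp
    then have "norm (f w + f v) \<le> norm (w + v)"
      using lip[of w "- v"] n by simp
    moreover have "norm (f w - f u) \<le> norm (w - u)"
      using lip n by simp
    moreover have "2 * norm w = norm ((f w - f u) + (f u - f v) + (f w + f v))"
      using norm_f[of w] n by (simp flip: scaleR_2)
    ultimately show ?thesis
      using norm_triangle_ineq[of "(f w - f u) + (f u - f v)" "f w + f v"]
        norm_triangle_ineq[of "f w - f u" "f u - f v"] by linarith
  qed
  have "norm (a - b) \<le> norm (f a - f b)"
  proof (rule norm_diff_le_if_walk)
    fix w :: 'a
    \<comment> \<open>Scaling by \<open>r\<close> brings the arbitrary vector \<open>w\<close> into
      the ball, where \<open>small\<close> applies; homogeneity then lets \<open>r\<close>
      cancel.\<close>
    define r where "r = inverse (1 + norm w)"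
    have r: "0 < r" "r \<le> 1" "r * norm w \<le> 1"
      unfolding r_def by (simp_all add: field_simps add_nonneg_pos add_pos_nonneg inverse_eq_divide)
    have n: "norm (r *\<^sub>R w) \<le> 1" "norm (r *\<^sub>R a) \<le> 1" "norm (r *\<^sub>R b) \<le> 1"
      using r ab by (simp_all add: mult_le_one)
    have "2 * norm (r *\<^sub>R w) \<le> norm (r *\<^sub>R (f a - f b)) + norm (r *\<^sub>R (w - a)) + norm (r *\<^sub>R (w + b))"
      using small[OF n] hom[OF ab(1), of r] hom[OF ab(2), of r] r
      unfolding scaleR_diff_right scaleR_add_right by simp
    then have "r * (2 * norm w) \<le> r * (norm (f a - f b) + norm (w - a) + norm (w + b))"
      using r by (simp add: distrib_left mult.left_commute)
    then show "2 * norm w \<le> norm (f a - f b) + norm (w - a) + norm (w + b)"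
      using r by simp
  qed
  then show "dist a b \<le> dist (f a) (f b)"
    by (simp add: dist_norm)
qed

section \<open>Non-expansive bijections between unit balls\<close>

locale ball_bijection =
  fixes F :: "'u::real_normed_vector \<Rightarrow> 'w::real_normed_vector"
  assumes bij: "bij_betw F (cball 0 1) (cball 0 1)"
    and nonexp: "non_expansive_on (cball 0 1) F"
begin

definition G :: "'w \<Rightarrow> 'u" where
  "G = inv_into (cball 0 1) F"

lemma norm_F_le_1: "norm z \<le> 1 \<Longrightarrow> norm (F z) \<le> 1"
  using bij by (force simp: bij_betw_def)

lemma norm_G_le_1: "norm w \<le> 1 \<Longrightarrow> norm (G w) \<le> 1"
  using bij_betw_inv_into[OF bij] by (force simp: bij_betw_def G_def)

lemma F_G: "norm w \<le> 1 \<Longrightarrow> F (G w) = w"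
  using bij_betw_inv_into_right[OF bij] by (simp add: G_def)

lemma F_inj: "F z = F z' \<Longrightarrow> norm z \<le> 1 \<Longrightarrow> norm z' \<le> 1 \<Longrightarrow> z = z'"
  using bij by (auto simp: bij_betw_def dest: inj_onD)

lemma G_F: "norm z \<le> 1 \<Longrightarrow> G (F z) = z"
  by (intro F_inj F_G norm_F_le_1 norm_G_le_1)

lemma F_lipschitz: "norm z \<le> 1 \<Longrightarrow> norm z' \<le> 1 \<Longrightarrow> norm (F z - F z') \<le> norm (z - z')"
  using nonexp by (auto simp: non_expansive_on_def dist_norm)

lemma continuous_on_F: "continuous_on (cball 0 1) F"
  by (rule lipschitz_on_continuous_on[of 1], rule lipschitz_onI)
    (use nonexp in \<open>auto simp: non_expansive_on_def\<close>)

text \<open>Otherwise the unit vector opposite to \<open>F 0\<close> would be farther than 1 from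
  \<open>F 0\<close>, although its preimage is within 1 of the origin.\<close>

lemma F_0: "F 0 = 0"
proof (rule ccontr)
  assume "F 0 \<noteq> 0"
  define y where "y = - sgn (F 0)"
  have y: "norm y = 1" using \<open>F 0 \<noteq> 0\<close> by (simp add: y_def norm_sgn)
  have "norm (F 0 - y) = norm (F 0) + 1"
  proof -
    have "F 0 - y = (norm (F 0) + 1) *\<^sub>R sgn (F 0)"
      using \<open>F 0 \<noteq> 0\<close> by (simp add: y_def sgn_div_norm algebra_simps)
    then show ?thesis
      using \<open>F 0 \<noteq> 0\<close> by (simp add: norm_sgn)
  qed
  moreover have "norm (F 0 - y) \<le> 1"
    using F_lipschitz[of 0 "G y"] F_G[of y] norm_G_le_1[of y] y by simp
  ultimately show False using \<open>F 0 \<noteq> 0\<close> by simp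
qed

lemma norm_F_le: "norm z \<le> 1 \<Longrightarrow> norm (F z) \<le> norm z"
  using F_lipschitz[of z 0] F_0 by simp

lemma norm_G_eq_1: "norm w = 1 \<Longrightarrow> norm (G w) = 1"
  using norm_F_le[of "G w"] norm_G_le_1[of w] F_G[of w] by simp

lemma G_expansive: "norm w \<le> 1 \<Longrightarrow> norm w' \<le> 1 \<Longrightarrow> norm (w - w') \<le> norm (G w - G w')"
  using F_lipschitz[of "G w" "G w'"] F_G norm_G_le_1 by simp

text \<open>\<open>F z\<close> is the sum of \<open>F z - F (t z)\<close> and
  \<open>F (t z)\<close>, whose norms are at most \<open>1 - t\<close> and \<open>t\<close>.\<close>

lemma F_scaleR_nonneg:
  assumes "rigid (F z)" "norm z \<le> 1" "0 \<le> t" "t \<le> 1"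
  shows "F (t *\<^sub>R z) = t *\<^sub>R F z"
proof (rule rigidD[OF assms(1), of "F z - F (t *\<^sub>R z)" "1 - t"])
  have tz: "norm (t *\<^sub>R z) \<le> t"
    using assms by (simp add: mult_left_le)
  then show "norm (F (t *\<^sub>R z)) \<le> t"
    using norm_F_le[of "t *\<^sub>R z"] assms by linarith
  have "z - t *\<^sub>R z = (1 - t) *\<^sub>R z" by (simp add: algebra_simps)
  then have "norm (z - t *\<^sub>R z) \<le> 1 - t"
    using assms by (simp add: mult_left_le)
  then show "norm (F z - F (t *\<^sub>R z)) \<le> 1 - t"
    using F_lipschitz[of z "t *\<^sub>R z"] tz assms by linarith
qed simp

text \<open>The midpoint \<open>m\<close> of \<open>z\<close> and of the preimage of
  \<open>- F z\<close> is within 1 of both. So \<open>F m\<close> is within 1 of \<open>F z\<close>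
  and \<open>- F z\<close>, which by rigidity forces \<open>F m = 0\<close>, and injectivity gives
  \<open>m = 0\<close>.\<close>

lemma F_minus:
  assumes "rigid (F z)" "norm z \<le> 1"
  shows "F (- z) = - F z"
proof -
  define z' where "z' = G (- F z)"
  have z': "F z' = - F z" "norm z' \<le> 1"
    using norm_F_le_1 assms by (auto simp: z'_def F_G norm_G_le_1)
  define m where "m = (1/2) *\<^sub>R (z + z')"
  have m: "norm m \<le> 1" "norm (z - m) \<le> 1" "norm (m - z') \<le> 1"
  proof -
    have "z - m = (1/2) *\<^sub>R (z - z')" "m - z' = (1/2) *\<^sub>R (z - z')"
      by (simp_all add: m_def algebra_simps flip: scaleR_2 scaleR_left_distrib)
    then show "norm m \<le> 1" "norm (z - m) \<le> 1" "norm (m - z') \<le> 1"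
      using norm_triangle_ineq4[of z z'] norm_triangle_ineq[of z z'] z' assms by (simp_all add: m_def)
  qed
  have "F m + F z = 1 *\<^sub>R F z"
  proof (rule rigidD[OF assms(1), of "F z - F m" 1])
    show "norm (F z - F m) \<le> 1"
      using F_lipschitz[of z m] m assms by linarith
    show "norm (F m + F z) \<le> 1"
      using F_lipschitz[of m z'] m z' by simp
  qed (simp add: scaleR_2)
  then have "m = 0"
    using F_inj[of m 0] F_0 m by simp
  then have "z' = - z"
    by (simp add: m_def add_eq_0_iff)
  then show ?thesis using z' by simp
qed

lemma F_scaleR:
  assumes "rigid (F z)" "norm z \<le> 1" "\<bar>t\<bar> \<le> 1"
  shows "F (t *\<^sub>R z) = t *\<^sub>R F z"
proof (cases "0 \<le> t")
  case True
  then show ?thesis using F_scaleR_nonneg assms by simp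
next
  case False
  then show ?thesis
    using F_scaleR_nonneg[of "- z" "- t"] F_minus[OF assms(1,2)] rigid_minus[OF assms(1)] assms
    by simp
qed

text \<open>With \<open>e\<close> the direction of \<open>F u\<close>, the points \<open>u\<close>
  and \<open>norm (F u) *\<^sub>R G e\<close> have the same image, so they agree. Thus every nonzero
  point lies on a ray through some \<open>G e\<close>, where \<open>F\<close> is linear.\<close>

lemma isometry_if_sphere_rigid:
  assumes "\<And>e::'w. norm e = 1 \<Longrightarrow> rigid e"
  shows "isometry_on (cball 0 1) F"
proof -
  have polar: "\<exists>s e. u = s *\<^sub>R G e \<and> norm e = 1 \<and> 0 \<le> s \<and> s \<le> 1"
    if "norm u \<le> 1" "u \<noteq> 0" for u
  proof -
    define e where "e = sgn (F u)"
    have "F u \<noteq> 0" using F_inj[of u 0] F_0 that by auto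
    then have e: "norm e = 1" "F u = norm (F u) *\<^sub>R e"
      by (simp_all add: e_def norm_sgn sgn_div_norm)
    have "F (norm (F u) *\<^sub>R G e) = norm (F u) *\<^sub>R e"
      using F_scaleR[of "G e" "norm (F u)"] assms[OF e(1)] F_G[of e] norm_G_le_1[of e] e(1)
        norm_F_le_1[OF that(1)] by simp
    then have "u = norm (F u) *\<^sub>R G e"
      using e norm_F_le_1[OF that(1)] norm_G_eq_1[OF e(1)] that by (intro F_inj) auto
    then show ?thesis
      using e norm_F_le_1[OF that(1)] by (intro exI[of _ "norm (F u)"]) auto
  qed
  have FG: "F (s *\<^sub>R G e) = s *\<^sub>R e" if "norm e = 1" "\<bar>s\<bar> \<le> 1" for s e
    using F_scaleR[of "G e" s] assms F_G[of e] norm_G_le_1[of e] that by simp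
  show ?thesis
  proof (rule isometry_on_ball_if_homogeneous[OF nonexp])
    fix u :: 'u and t :: real assume u: "norm u \<le> 1" and t: "\<bar>t\<bar> \<le> 1"
    show "F (t *\<^sub>R u) = t *\<^sub>R F u"
    proof (cases "u = 0")
      case False
      with polar[OF u] obtain s e where "u = s *\<^sub>R G e" "norm e = 1" "0 \<le> s" "s \<le> 1" by blast
      then show ?thesis
        using FG[of e "t * s"] FG[of e s] t by (simp add: abs_mult mult_le_one)
    qed (simp add: F_0)
  next
    fix u :: 'u assume u: "norm u \<le> 1"
    show "norm (F u) = norm u"
    proof (cases "u = 0")
      case False
      with polar[OF u] obtain s e where "u = s *\<^sub>R G e" "norm e = 1" "0 \<le> s" "s \<le> 1" by blast
      then show ?thesis
        using FG[of e s] norm_G_eq_1[of e] by simp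
    qed (simp add: F_0)
  qed
qed

end

section \<open>Bijections between unit balls of maximum sums\<close>

definition swap :: "('a, 'b) linf_sum \<Rightarrow> ('b, 'a) linf_sum" where
  "swap z = Linf (linf_snd z) (linf_fst z)"

lemma swap_Linf [simp]: "swap (Linf x y) = Linf y x"
  by (simp add: swap_def)

lemma swap_swap [simp]: "swap (swap z) = z"
  by (simp add: swap_def)

lemma linf_fst_swap [simp]: "linf_fst (swap z) = linf_snd z"
  and linf_snd_swap [simp]: "linf_snd (swap z) = linf_fst z"
  by (simp_all add: swap_def)

lemma norm_swap [simp]: "norm (swap z) = norm z"
  by (simp add: norm_linf_sum_def max.commute)

lemma dist_swap [simp]: "dist (swap z) (swap w) = dist z w"
  by (simp add: dist_linf_sum_def norm_linf_sum_def max.commute)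

lemma bij_swap: "bij_betw swap (cball 0 1) (cball 0 1)"
  by (rule bij_betwI[of _ _ _ swap]) auto

lemma isometry_on_swap_comp [simp]: "isometry_on M (swap \<circ> F) \<longleftrightarrow> isometry_on M F"
  by (simp add: isometry_on_def)

lemma ball_bijection_swap_comp:
  assumes "ball_bijection F"
  shows "ball_bijection (swap \<circ> F)"
proof -
  interpret ball_bijection F by fact
  show ?thesis
    by unfold_locales (use bij_betw_trans[OF bij bij_swap] nonexp in \<open>auto simp: non_expansive_on_def\<close>)
qed

lemma ball_bijection_comp_swap:
  assumes "ball_bijection F"
  shows "ball_bijection (F \<circ> swap)"
proof -
  interpret ball_bijection F by fact
  have "dist (F (swap u)) (F (swap v)) \<le> dist u v" if "norm u \<le> 1" "norm v \<le> 1" for u v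
    using nonexp that unfolding non_expansive_on_def by (metis dist_swap mem_cball_0 norm_swap)
  then show ?thesis
    by unfold_locales (use bij_betw_trans[OF bij_swap bij] in \<open>auto simp: non_expansive_on_def\<close>)
qed

lemma exists_polar:
  assumes "\<exists>x::'a::real_normed_vector. norm x = 1"
  shows "\<exists>x::'a. norm x = 1 \<and> a = norm a *\<^sub>R x"
proof (cases "a = 0")
  case False
  then show ?thesis
    by (intro exI[of _ "sgn a"]) (simp add: norm_sgn sgn_div_norm)
qed (use assms in auto)

text \<open>Four independent factor types keep the setting closed under exchanging the factors on
  either side.\<close>

locale linf_bijection = ball_bijection F
  for F :: "('a::real_normed_vector, 'b::real_normed_vector) linf_sum
    \<Rightarrow> ('c::real_normed_vector, 'd::real_normed_vector) linf_sum" +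
  assumes rigid_a: "\<And>e::'a. norm e = 1 \<Longrightarrow> rigid e"
    and rigid_b: "\<And>e::'b. norm e = 1 \<Longrightarrow> rigid e"
    and rigid_c: "\<And>e::'c. norm e = 1 \<Longrightarrow> rigid e"
    and rigid_d: "\<And>e::'d. norm e = 1 \<Longrightarrow> rigid e"
    and ex_c: "\<exists>x::'c. norm x = 1"
    and ex_d: "\<exists>y::'d. norm y = 1"
begin

lemma rigid_corner: "norm x = 1 \<Longrightarrow> norm y = 1 \<Longrightarrow> rigid (Linf x y :: ('c, 'd) linf_sum)"
  by (intro rigid_Linf rigid_c rigid_d)

end

section \<open>Bijections whose inverse has product form on corners\<close>

locale linf_cross = linf_bijection F
  for F :: "('a::real_normed_vector, 'b::real_normed_vector) linf_sum
    \<Rightarrow> ('c::real_normed_vector, 'd::real_normed_vector) linf_sum" +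
  fixes p :: "'c \<Rightarrow> 'a" and q :: "'d \<Rightarrow> 'b"
  assumes norm_p: "norm x = 1 \<Longrightarrow> norm (p x) = 1"
    and norm_q: "norm y = 1 \<Longrightarrow> norm (q y) = 1"
    and F_pq: "norm x = 1 \<Longrightarrow> norm y = 1 \<Longrightarrow> F (Linf (p x) (q y)) = Linf x y"
begin

text \<open>Through this conjugation each fact about the first coordinate yields its twin for the
  second.\<close>

lemma linf_cross_swap: "linf_cross (swap \<circ> F \<circ> swap) q p"
proof -
  interpret sw: ball_bijection "swap \<circ> F \<circ> swap"
    using ball_bijection_swap_comp ball_bijection_comp_swap ball_bijection_axioms
    by (metis comp_assoc)
  show ?thesis
    by unfold_locales
      (simp_all add: rigid_a rigid_b rigid_c rigid_d ex_c ex_d norm_p norm_q F_pq)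
qed

lemma F_scaled_pq:
  assumes "norm x = 1" "norm y = 1" "\<bar>t\<bar> \<le> 1"
  shows "F (Linf (t *\<^sub>R p x) (t *\<^sub>R q y)) = Linf (t *\<^sub>R x) (t *\<^sub>R y)"
  using F_scaleR[of "Linf (p x) (q y)" t] F_pq norm_p norm_q rigid_corner assms
  by (simp add: scaleR_Linf)

lemma pq_minus:
  assumes "norm x = 1" "norm y = 1"
  shows "p (- x) = - p x \<and> q (- y) = - q y"
proof -
  have "F (Linf (p (- x)) (q (- y))) = F (Linf (- p x) (- q y))"
    using F_scaled_pq[of x y "-1"] F_pq[of "- x" "- y"] assms by simp
  then show ?thesis
    using F_inj norm_p[of x] norm_q[of y] norm_p[of "- x"] norm_q[of "- y"] assms by fastforce
qed

lemma p_minus: "norm x = 1 \<Longrightarrow> p (- x) = - p x"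
  using pq_minus ex_d by blast

lemma q_minus: "norm y = 1 \<Longrightarrow> q (- y) = - q y"
  using pq_minus ex_c by blast

lemma G_pq: "norm x = 1 \<Longrightarrow> norm y = 1 \<Longrightarrow> G (Linf x y) = Linf (p x) (q y)"
  using G_F[of "Linf (p x) (q y)"] F_pq norm_p norm_q by simp

text \<open>The smaller coordinate is determined because \<open>(a p x, b q y)\<close> is at distance \<open>b \<mp> a\<close>
  from \<open>(\<plusminus>b p x, b q y)\<close>, whose images are known.\<close>

lemma linf_fst_F:
  assumes x: "norm x = 1" and y: "norm y = 1" and ab: "0 \<le> a" "a \<le> b" "b \<le> 1"
  shows "linf_fst (F (Linf (a *\<^sub>R p x) (b *\<^sub>R q y))) = a *\<^sub>R x"
proof -
  let ?z = "Linf (a *\<^sub>R p x) (b *\<^sub>R q y)"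
  define x' where "x' = linf_fst (F ?z)"
  have z: "norm ?z \<le> 1" using assms norm_p norm_q by simp
  have dist: "norm (x' - t *\<^sub>R x) \<le> b - s * a" if t: "t = s * b" and s: "s = 1 \<or> s = -1" for s t
  proof -
    have 1: "F (Linf (t *\<^sub>R p x) (b *\<^sub>R q y)) = Linf (t *\<^sub>R x) (b *\<^sub>R y)"
      using s t F_scaled_pq[of x y b] F_scaled_pq[of "- x" y b] assms p_minus by auto
    have "norm (x' - t *\<^sub>R x) \<le> norm (F ?z - Linf (t *\<^sub>R x) (b *\<^sub>R y))"
      by (simp add: x'_def norm_linf_sum_def)
    also have "\<dots> \<le> norm (?z - Linf (t *\<^sub>R p x) (b *\<^sub>R q y))"
      unfolding 1[symmetric] using z s t assms norm_p norm_q
      by (intro F_lipschitz) auto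
    also have "\<dots> = norm ((a - t) *\<^sub>R p x)"
      by (simp add: minus_Linf scaleR_diff_left)
    also have "\<dots> = b - s * a"
      using s t ab norm_p[OF x] by auto
    finally show ?thesis .
  qed
  \<comment> \<open>The radii \<open>b - a\<close> and \<open>b + a\<close> add up to
    \<open>2 b\<close>, the distance from \<open>b x\<close> to \<open>- b x\<close>.\<close>
  have "x' + b *\<^sub>R x = (b + a) *\<^sub>R x"
  proof (rule rigidD[OF rigid_c[OF x], of "b *\<^sub>R x - x'" "b - a"])
    show "norm (b *\<^sub>R x - x') \<le> b - a"
      using dist[of b 1] by (simp add: norm_minus_commute)
    show "norm (x' + b *\<^sub>R x) \<le> b + a"
      using dist[of "- b" "-1"] by simp
  qed (simp only: scaleR_left_distrib scaleR_diff_left, simp)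
  then show ?thesis
    by (simp add: x'_def algebra_simps)
qed

lemma linf_snd_F:
  assumes "norm x = 1" "norm y = 1" "0 \<le> b" "b \<le> a" "a \<le> 1"
  shows "linf_snd (F (Linf (a *\<^sub>R p x) (b *\<^sub>R q y))) = b *\<^sub>R y"
proof -
  interpret sw: linf_cross "swap \<circ> F \<circ> swap" q p by (rule linf_cross_swap)
  show ?thesis
    using sw.linf_fst_F[of y x b a] assms by simp
qed

text \<open>For every unit \<open>y\<close>, the point \<open>(x, b)\<close> is at distance at least
  2 from \<open>(- x, - y)\<close>, so its preimage shares a coordinate with
  \<open>(p x, q y)\<close>. Sharing the second one for both \<open>y\<close> and \<open>- y\<close>
  is impossible since \<open>q\<close> is odd.\<close>

lemma linf_fst_G_facet:
  assumes x: "norm x = 1" and b: "norm b \<le> 1"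
  shows "linf_fst (G (Linf x b)) = p x"
proof -
  define z where "z = G (Linf x b)"
  obtain y :: 'd where y: "norm y = 1" using ex_d by blast
  have z: "norm (linf_fst z) \<le> 1" "norm (linf_snd z) \<le> 1"
    using norm_G_le_1[of "Linf x b"] assms by (simp_all add: z_def norm_linf_sum_def)
  have far: "linf_fst z = p x \<or> linf_snd z = q y" if y: "norm y = 1" for y
  proof -
    have "2 \<le> norm (x + x)" using x by (simp flip: scaleR_2)
    also have "\<dots> \<le> norm (Linf x b - Linf (- x) (- y))" by (simp add: norm_linf_sum_def)
    also have "\<dots> \<le> norm (z - G (Linf (- x) (- y)))"
      unfolding z_def using assms y by (intro G_expansive) auto
    also have "\<dots> = max (norm (linf_fst z + p x)) (norm (linf_snd z + q y))"
      using G_pq[of "- x" "- y"] p_minus q_minus x y by (simp add: norm_linf_sum_def)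
    finally show ?thesis
      using eq_if_norm_add_eq_2[of "linf_fst z" "p x"] eq_if_norm_add_eq_2[of "linf_snd z" "q y"]
        rigid_a rigid_b z norm_p[OF x] norm_q[OF y] by (simp add: le_max_iff_disj) blast
  qed
  have "linf_fst z = p x"
  proof (rule ccontr)
    assume "linf_fst z \<noteq> p x"
    then have "q y = q (- y)" using far[of y] far[of "- y"] y by auto
    then have "2 *\<^sub>R q y = 0" using q_minus[OF y] by (simp add: scaleR_2 eq_neg_iff_add_eq_0)
    then show False using norm_q[OF y] by auto
  qed
  then show ?thesis by (simp add: z_def)
qed

section \<open>Surjectivity of \<open>p\<close> and \<open>q\<close> by connectedness\<close>

definition h :: "('a, 'b) linf_sum \<Rightarrow> real" where
  "h z = norm (linf_fst (F z)) - norm (linf_snd (F z))"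

text \<open>The coordinates of \<open>F z\<close> have equal norm, so \<open>F z\<close> is a
  multiple of a corner and its preimage is known. Hence the zero set of \<open>h\<close> in the ball
  is the cone over the points \<open>(p x, q y)\<close>.\<close>

lemma h_eq_0:
  assumes "norm z \<le> 1" "h z = 0"
  shows "\<exists>t x y. norm x = 1 \<and> norm y = 1 \<and> 0 \<le> t \<and> t \<le> 1 \<and> z = Linf (t *\<^sub>R p x) (t *\<^sub>R q y)"
proof -
  define t where "t = norm (linf_fst (F z))"
  obtain x where x: "norm x = 1" "linf_fst (F z) = t *\<^sub>R x"
    using exists_polar[OF ex_c] unfolding t_def by blast
  obtain y where y: "norm y = 1" "linf_snd (F z) = t *\<^sub>R y"
    using exists_polar[OF ex_d, of "linf_snd (F z)"] assms(2) unfolding t_def h_def by auto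
  have t: "0 \<le> t" "t \<le> 1"
    using norm_F_le_1[OF assms(1)] by (simp_all add: t_def norm_linf_sum_def)
  have "F z = Linf (t *\<^sub>R x) (t *\<^sub>R y)"
    using x(2) y(2) by (simp add: linf_sum.expand)
  also have "\<dots> = F (Linf (t *\<^sub>R p x) (t *\<^sub>R q y))"
    using F_scaled_pq x y t by simp
  finally have "z = Linf (t *\<^sub>R p x) (t *\<^sub>R q y)"
    using F_inj assms x y t norm_p norm_q by simp
  then show ?thesis using x y t by blast
qed

lemma h_neq_0:
  assumes "norm u \<le> 1" "norm v \<le> 1" "norm u \<noteq> norm v"
  shows "h (Linf u v) \<noteq> 0"
proof
  assume "h (Linf u v) = 0"
  then obtain t x y where "norm x = 1" "norm y = 1" "u = t *\<^sub>R p x" "v = t *\<^sub>R q y"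
    using h_eq_0[of "Linf u v"] assms by auto
  then show False using assms norm_p norm_q by simp
qed

lemma h_0: "h 0 = 0"
  by (simp add: h_def F_0)

lemma continuous_on_h: "continuous_on (cball 0 1) h"
proof -
  have "1-lipschitz_on UNIV (linf_fst :: ('c, 'd) linf_sum \<Rightarrow> 'c)"
    "1-lipschitz_on UNIV (linf_snd :: ('c, 'd) linf_sum \<Rightarrow> 'd)"
    by (rule lipschitz_onI; simp add: dist_norm norm_linf_sum_def)+
  then have "continuous_on UNIV (linf_fst :: ('c, 'd) linf_sum \<Rightarrow> 'c)"
    "continuous_on UNIV (linf_snd :: ('c, 'd) linf_sum \<Rightarrow> 'd)"
    using lipschitz_on_continuous_on by blast+
  from this[THEN continuous_on_compose2, OF continuous_on_F]
  show ?thesis unfolding h_def by (intro continuous_intros) auto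
qed

lemma sgn_h_eq_segment:
  assumes "norm z \<le> 1" "norm w \<le> 1" "\<And>v. v \<in> closed_segment z w \<Longrightarrow> h v \<noteq> 0"
  shows "sgn (h z) = sgn (h w)"
proof (rule ccontr)
  assume "sgn (h z) \<noteq> sgn (h w)"
  have "closed_segment z w \<subseteq> cball 0 1"
    using assms by (intro closed_segment_subset) auto
  then have "connected (h ` closed_segment z w)"
    by (intro connected_continuous_image continuous_on_subset[OF continuous_on_h]) auto
  moreover have "h z \<in> h ` closed_segment z w" "h w \<in> h ` closed_segment z w"
    by auto
  moreover have "h z < 0 \<and> 0 < h w \<or> h w < 0 \<and> 0 < h z"
    using \<open>sgn (h z) \<noteq> sgn (h w)\<close> assms(3)[of z] assms(3)[of w] by (auto simp: sgn_if split: if_splits)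
  ultimately have "0 \<in> h ` closed_segment z w"
    using connectedD_interval[of "h ` closed_segment z w" "h z" "h w" 0]
      connectedD_interval[of "h ` closed_segment z w" "h w" "h z" 0] by auto
  then show False using assms(3) by auto
qed

text \<open>Past the start of the segment the second coordinate is strictly shorter than
  \<open>u\<close>, and \<open>h\<close> does not vanish where the two norms differ.\<close>

lemma sgn_h_drop_snd:
  assumes "norm u \<le> 1" "norm v \<le> norm u" "h (Linf u v) \<noteq> 0"
  shows "sgn (h (Linf u v)) = sgn (h (Linf u 0))"
proof (rule sgn_h_eq_segment)
  fix w assume "w \<in> closed_segment (Linf u v) (Linf u 0)"
  then obtain t where t: "0 \<le> t" "t \<le> 1"
    "w = (1 - t) *\<^sub>R Linf u v + t *\<^sub>R Linf u 0"
    unfolding in_segment by blast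
  then have w: "w = Linf u ((1 - t) *\<^sub>R v)"
    by (intro linf_sum.expand) (simp flip: scaleR_left_distrib)
  have "u \<noteq> 0" using assms h_0 by (auto simp: zero_linf_sum_def)
  show "h w \<noteq> 0"
  proof (cases "t = 0")
    case False
    have "(1 - t) * norm v \<le> (1 - t) * norm u"
      using assms t by (intro mult_left_mono) auto
    also have "\<dots> < norm u"
      using False t \<open>u \<noteq> 0\<close> by simp
    finally show ?thesis
      unfolding w using assms t by (intro h_neq_0) auto
  qed (use w assms in simp)
qed (use assms in auto)

text \<open>On the axis the only zero of \<open>h\<close> is the origin, which the segment
  avoids.\<close>

lemma sgn_h_move_fst:
  assumes "norm u \<le> 1" "norm w \<le> 1" "0 \<notin> closed_segment u w"
  shows "sgn (h (Linf u 0)) = sgn (h (Linf w 0))"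
proof (rule sgn_h_eq_segment)
  fix v assume "v \<in> closed_segment (Linf u 0) (Linf w 0 :: ('a, 'b) linf_sum)"
  then obtain t where t: "0 \<le> t" "t \<le> 1"
    "v = (1 - t) *\<^sub>R Linf u 0 + t *\<^sub>R Linf w 0"
    unfolding in_segment by blast
  define m where "m = (1 - t) *\<^sub>R u + t *\<^sub>R w"
  have v: "v = Linf m 0"
    using t by (intro linf_sum.expand) (simp add: m_def)
  have m: "m \<in> closed_segment u w"
    unfolding in_segment m_def using t by blast
  then have "m \<noteq> 0" using assms by blast
  have "m \<in> cball 0 1"
    using m closed_segment_subset[of u "cball 0 1" w] assms by auto
  then show "h v \<noteq> 0"
    unfolding v using \<open>m \<noteq> 0\<close> by (intro h_neq_0) auto
qed (use assms in auto)

lemma h_swap: "linf_cross.h (swap \<circ> F \<circ> swap) (Linf v u) = - h (Linf u v)"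
proof -
  interpret sw: linf_cross "swap \<circ> F \<circ> swap" q p by (rule linf_cross_swap)
  show ?thesis unfolding sw.h_def h_def by simp
qed

lemma sgn_h_drop_fst:
  assumes "norm v \<le> 1" "norm u \<le> norm v" "h (Linf u v) \<noteq> 0"
  shows "sgn (h (Linf u v)) = sgn (h (Linf 0 v))"
proof -
  interpret sw: linf_cross "swap \<circ> F \<circ> swap" q p by (rule linf_cross_swap)
  show ?thesis
    using sw.sgn_h_drop_snd[of v u] assms by (simp add: h_swap sgn_minus)
qed

text \<open>If the corner \<open>(u0, v0)\<close> is not hit, then neither are \<open>(\<plusminus>u0, \<plusminus>v0)\<close>, so one can pass
  through it between the regions \<open>\<parallel>u\<parallel> > \<parallel>v\<parallel>\<close> and \<open>\<parallel>u\<parallel> < \<parallel>v\<parallel>\<close> while avoiding the zeros of \<open>h\<close>.\<close>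

lemma sgn_h_const:
  assumes u0: "norm u0 = 1" and v0: "norm v0 = 1"
    and miss: "\<And>x y. norm x = 1 \<Longrightarrow> norm y = 1 \<Longrightarrow> p x = u0 \<Longrightarrow> q y \<noteq> v0"
    and uv: "norm u \<le> 1" "norm v \<le> norm u" "h (Linf u v) \<noteq> 0"
  shows "sgn (h (Linf u v)) = sgn (h (Linf u0 v0))"
proof -
  \<comment> \<open>A zero here would lie at the base of the cone, \<open>t = 1\<close>, and oddness
    of \<open>p\<close> would then produce the missed corner.\<close>
  have corner: "h (Linf u1 v0) \<noteq> 0" if u1: "u1 = u0 \<or> u1 = - u0" for u1
  proof
    assume "h (Linf u1 v0) = 0"
    moreover have n: "norm u1 = 1" using u1 u0 by auto
    ultimately obtain t x y where txy: "norm x = 1" "norm y = 1" "0 \<le> t"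
      "u1 = t *\<^sub>R p x" "v0 = t *\<^sub>R q y"
      using h_eq_0[of "Linf u1 v0"] v0 by auto
    then have "t = 1" using n norm_p by simp
    then show False
      using u1 txy miss[of x y] miss[of "- x" y] p_minus[of x] by auto
  qed
  have 1: "sgn (h (Linf u1 0)) = sgn (h (Linf 0 v0))" if u1: "u1 = u0 \<or> u1 = - u0" for u1
    using sgn_h_drop_snd[of u1 v0] sgn_h_drop_fst[of v0 u1] corner[OF u1] u0 v0 u1 by auto
  have 2: "sgn (h (Linf u0 v0)) = sgn (h (Linf 0 v0))"
    using sgn_h_drop_fst[of v0 u0] corner[of u0] u0 v0 by auto
  have "u \<noteq> 0" using uv h_0 by (auto simp: zero_linf_sum_def)
  \<comment> \<open>Otherwise \<open>u\<close> would be a negative multiple of both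
    \<open>u0\<close> and \<open>- u0\<close>. So one of the two can be reached from
    \<open>u\<close> along the axis without meeting 0.\<close>
  have "\<not> (0 \<in> closed_segment u u0 \<and> 0 \<in> closed_segment u (- u0))"
  proof
    assume "0 \<in> closed_segment u u0 \<and> 0 \<in> closed_segment u (- u0)"
    then obtain s t where st: "0 \<le> s" "s \<le> 1" "0 \<le> t" "t \<le> 1"
      "(1 - s) *\<^sub>R u + s *\<^sub>R u0 = 0" "(1 - t) *\<^sub>R u = t *\<^sub>R u0"
      unfolding in_segment by auto
    have "u0 \<noteq> 0" using u0 by auto
    have "s < 1" using st \<open>u0 \<noteq> 0\<close> by (cases "s = 1") auto
    have "t > 0" using st \<open>u \<noteq> 0\<close> by (cases "t = 0") auto
    have "(1 - t) *\<^sub>R ((1 - s) *\<^sub>R u + s *\<^sub>R u0) = (1 - s) *\<^sub>R ((1 - t) *\<^sub>R u) + ((1 - t) * s) *\<^sub>R u0"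
      by (simp add: algebra_simps)
    also have "\<dots> = ((1 - s) * t + (1 - t) * s) *\<^sub>R u0"
      unfolding st(6) by (simp only: scaleR_scaleR scaleR_left_distrib)
    finally have "(1 - s) * t + (1 - t) * s = 0"
      using st(5) \<open>u0 \<noteq> 0\<close> by simp
    moreover have "(1 - s) * t > 0" "(1 - t) * s \<ge> 0"
      using \<open>s < 1\<close> \<open>t > 0\<close> st by auto
    ultimately show False by linarith
  qed
  then obtain u1 where u1: "u1 = u0 \<or> u1 = - u0" "0 \<notin> closed_segment u u1" by blast
  have "sgn (h (Linf u v)) = sgn (h (Linf u 0))"
    using sgn_h_drop_snd uv by blast
  also have "\<dots> = sgn (h (Linf u1 0))"
    using sgn_h_move_fst[of u u1] u1 u0 uv by auto
  finally show ?thesis using 1[OF u1(1)] 2 by simp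
qed

text \<open>If the corner were missed, \<open>h\<close> would have one constant sign off its zeros,
  yet it is 1 and -1 at the preimages of \<open>(x, 0)\<close> and \<open>(0, y)\<close>.\<close>

lemma pq_surj:
  assumes u0: "norm u0 = 1" and v0: "norm v0 = 1"
  shows "\<exists>x y. norm x = 1 \<and> norm y = 1 \<and> p x = u0 \<and> q y = v0"
proof (rule ccontr)
  assume neg: "\<not> ?thesis"
  interpret sw: linf_cross "swap \<circ> F \<circ> swap" q p by (rule linf_cross_swap)
  have const: "sgn (h z) = sgn (h (Linf u0 v0))" if z: "norm z \<le> 1" "h z \<noteq> 0" for z
  proof (cases z)
    case (Linf u v)
    show ?thesis
    proof (cases "norm v \<le> norm u")
      case True
      then show ?thesis
        unfolding Linf by (intro sgn_h_const) (use neg z u0 v0 Linf in auto)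
    next
      case False
      have "sgn (sw.h (Linf v u)) = sgn (sw.h (Linf v0 u0))"
        by (intro sw.sgn_h_const) (use neg z u0 v0 Linf False in \<open>auto simp: h_swap\<close>)
      then show ?thesis by (simp add: Linf h_swap sgn_minus)
    qed
  qed
  obtain x :: 'c and y :: 'd where xy: "norm x = 1" "norm y = 1"
    using ex_c ex_d by blast
  have "h (G (Linf x 0)) = 1" "h (G (Linf 0 y)) = - 1"
    using xy by (simp_all add: h_def F_G)
  then show False
    using const[of "G (Linf x 0)"] const[of "G (Linf 0 y)"] norm_G_le_1[of "Linf x 0"]
      norm_G_le_1[of "Linf 0 y"] xy by simp
qed

section \<open>Product form of \<open>F\<close> on the whole ball\<close>

lemma polar_p: "\<exists>x. norm x = 1 \<and> u = norm u *\<^sub>R p x"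
proof -
  obtain x :: 'c and y :: 'd where xy: "norm x = 1" "norm y = 1"
    using ex_c ex_d by blast
  then obtain u' where "norm u' = 1" "u = norm u *\<^sub>R u'"
    using exists_polar[of u] norm_p by blast
  then show ?thesis
    using pq_surj[of u' "q y"] norm_q xy by blast
qed

lemma polar_q: "\<exists>y. norm y = 1 \<and> v = norm v *\<^sub>R q y"
proof -
  interpret sw: linf_cross "swap \<circ> F \<circ> swap" q p by (rule linf_cross_swap)
  show ?thesis by (rule sw.polar_p)
qed

text \<open>The preimage of \<open>(x, b y)\<close> has first coordinate \<open>p x\<close>. Writing
  its second one as a multiple of some \<open>q y'\<close> makes \<open>linf_snd_F\<close>
  applicable, and comparing images identifies it.\<close>

lemma F_facet:
  assumes x: "norm x = 1" and y: "norm y = 1" and b: "0 \<le> b" "b \<le> 1"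
  shows "F (Linf (p x) (b *\<^sub>R q y)) = Linf x (b *\<^sub>R y)"
proof -
  define c where "c = linf_snd (G (Linf x (b *\<^sub>R y)))"
  have n: "norm (Linf x (b *\<^sub>R y)) \<le> 1" using assms by simp
  have G: "G (Linf x (b *\<^sub>R y)) = Linf (p x) c"
    using linf_fst_G_facet[of x "b *\<^sub>R y"] assms by (intro linf_sum.expand) (simp add: c_def)
  then have F: "F (Linf (p x) c) = Linf x (b *\<^sub>R y)"
    using F_G[OF n] by simp
  have c1: "norm c \<le> 1" using norm_G_le_1[OF n] G by simp
  obtain y' where y': "norm y' = 1" "c = norm c *\<^sub>R q y'" using polar_q by blast
  then have eq: "norm c *\<^sub>R y' = b *\<^sub>R y"
    using linf_snd_F[of x y' "norm c" 1] F c1 x by simp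
  then have "norm c = b"
    using y' y b by (metis abs_norm_cancel abs_of_nonneg mult.right_neutral norm_scaleR)
  \<comment> \<open>For \<open>b = 0\<close> the direction \<open>y'\<close> is unrelated to
    \<open>y\<close>, but then \<open>c\<close> is zero.\<close>
  then have "c = b *\<^sub>R q y"
    using eq y' by (cases "b = 0") auto
  then show ?thesis using F by simp
qed

text \<open>The point is \<open>a\<close> times the facet point \<open>(p x, (b / a) q y)\<close>.
  Its image is within \<open>1 - a\<close> of the image of that point and within \<open>a\<close> of
  0, which fixes the larger coordinate; \<open>linf_snd_F\<close> gives the smaller.\<close>

lemma F_product_ge:
  assumes x: "norm x = 1" and y: "norm y = 1" and ab: "0 \<le> b" "b \<le> a" "a \<le> 1"
  shows "F (Linf (a *\<^sub>R p x) (b *\<^sub>R q y)) = Linf (a *\<^sub>R x) (b *\<^sub>R y)"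
proof (cases "a = 0")
  case True
  then show ?thesis using ab F_0 by (simp flip: zero_linf_sum_def)
next
  case False
  let ?z = "Linf (a *\<^sub>R p x) (b *\<^sub>R q y)"
  define x' where "x' = linf_fst (F ?z)"
  define t where "t = b / a"
  have t: "0 \<le> t" "t \<le> 1" "b = a * t" using False ab by (simp_all add: t_def)
  have z: "norm ?z \<le> a" using assms norm_p norm_q by simp
  have w: "norm (Linf (p x) (t *\<^sub>R q y)) \<le> 1" using t x y norm_p norm_q by simp
  have "Linf (p x) (t *\<^sub>R q y) - ?z = (1 - a) *\<^sub>R Linf (p x) (t *\<^sub>R q y)"
    by (simp add: minus_Linf scaleR_Linf t algebra_simps)
  then have "norm (Linf (p x) (t *\<^sub>R q y) - ?z) \<le> 1 - a"
    using w ab by (simp only: norm_scaleR) (simp add: mult_left_le)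
  then have "norm (Linf x (t *\<^sub>R y) - F ?z) \<le> 1 - a"
    using F_lipschitz[OF w, of ?z] F_facet[OF x y t(1,2)] z ab by simp
  then have "norm (x - x') \<le> 1 - a"
    by (simp add: x'_def norm_linf_sum_def)
  moreover have "norm x' \<le> a"
    using norm_F_le[of ?z] z ab unfolding x'_def norm_linf_sum_def[of "F ?z"] by linarith
  ultimately have "x' = a *\<^sub>R x"
    using rigidD[OF rigid_c[OF x], of "x - x'" "1 - a" x' a] by simp
  then show ?thesis
    using linf_snd_F[OF assms] by (intro linf_sum.expand) (simp add: x'_def)
qed

lemma F_product:
  assumes "norm x = 1" "norm y = 1" "0 \<le> a" "a \<le> 1" "0 \<le> b" "b \<le> 1"
  shows "F (Linf (a *\<^sub>R p x) (b *\<^sub>R q y)) = Linf (a *\<^sub>R x) (b *\<^sub>R y)"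
proof (cases "b \<le> a")
  case True
  then show ?thesis using F_product_ge assms by blast
next
  case False
  interpret sw: linf_cross "swap \<circ> F \<circ> swap" q p by (rule linf_cross_swap)
  have "swap (F (Linf (a *\<^sub>R p x) (b *\<^sub>R q y))) = Linf (b *\<^sub>R y) (a *\<^sub>R x)"
    using sw.F_product_ge[of y x a b] False assms by simp
  then show ?thesis by (metis swap_Linf swap_swap)
qed

lemma isometry_on_fst: "isometry_on (cball 0 1) (\<lambda>u. linf_fst (F (Linf u 0)))"
proof -
  define f where "f u = linf_fst (F (Linf u 0))" for u
  obtain y :: 'd where y: "norm y = 1" using ex_d by blast
  have f_nonneg: "f (a *\<^sub>R p x) = a *\<^sub>R x" if "norm x = 1" "0 \<le> a" "a \<le> 1" for a x
    using F_product[of x y a 0] that y by (simp add: f_def)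
  have f: "f (a *\<^sub>R p x) = a *\<^sub>R x" if "norm x = 1" "\<bar>a\<bar> \<le> 1" for a x
    using f_nonneg[of x a] f_nonneg[of "- x" "- a"] p_minus[of x] that by (cases "0 \<le> a") auto
  have "isometry_on (cball 0 1) f"
  proof (rule isometry_on_ball_if_homogeneous)
    show "non_expansive_on (cball 0 1) f"
      unfolding non_expansive_on_def
    proof (intro ballI)
      fix u v :: 'a assume "u \<in> cball 0 1" "v \<in> cball 0 1"
      then have "norm (F (Linf u 0) - F (Linf v 0)) \<le> norm (u - v)"
        using F_lipschitz[of "Linf u 0" "Linf v 0"] by (simp add: minus_Linf)
      then show "dist (f u) (f v) \<le> dist u v"
        by (simp add: f_def dist_norm norm_linf_sum_def)
    qed
  next
    fix u :: 'a and t :: real assume "norm u \<le> 1" "\<bar>t\<bar> \<le> 1"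
    moreover obtain x where x: "norm x = 1" "u = norm u *\<^sub>R p x" using polar_p by blast
    ultimately show "f (t *\<^sub>R u) = t *\<^sub>R f u"
      using f[of x "norm u"] f[of x "t * norm u"]
      by (metis abs_mult abs_norm_cancel mult_le_one norm_ge_zero scaleR_scaleR)
  next
    fix u :: 'a assume "norm u \<le> 1"
    moreover obtain x where x: "norm x = 1" "u = norm u *\<^sub>R p x" using polar_p by blast
    ultimately show "norm (f u) = norm u"
      using f[of x "norm u"] by simp
  qed
  then show ?thesis unfolding f_def .
qed

lemma isometry_on_snd: "isometry_on (cball 0 1) (\<lambda>v. linf_snd (F (Linf 0 v)))"
proof -
  interpret sw: linf_cross "swap \<circ> F \<circ> swap" q p by (rule linf_cross_swap)
  show ?thesis using sw.isometry_on_fst by simp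
qed

text \<open>\<open>F\<close> is the product of its two axis maps, and the maximum norm combines
  their isometry.\<close>

lemma isometry_F: "isometry_on (cball 0 1) F"
proof -
  have prod: "F (Linf u v) = Linf (linf_fst (F (Linf u 0))) (linf_snd (F (Linf 0 v)))"
    if "norm u \<le> 1" "norm v \<le> 1" for u v
  proof -
    obtain x where x: "norm x = 1" "u = norm u *\<^sub>R p x" using polar_p by blast
    obtain y where y: "norm y = 1" "v = norm v *\<^sub>R q y" using polar_q by blast
    show ?thesis
      using F_product[of x y "norm u" "norm v"] F_product[of x y "norm u" 0]
        F_product[of x y 0 "norm v"] x y that by simp
  qed
  show ?thesis
    unfolding isometry_on_def
  proof (intro ballI)
    fix z w :: "('a, 'b) linf_sum"
    assume "z \<in> cball 0 1" "w \<in> cball 0 1"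
    moreover obtain u v u' v' where "z = Linf u v" "w = Linf u' v'"
      by (meson linf_sum.exhaust)
    ultimately show "dist (F z) (F w) = dist z w"
      using isometry_on_fst isometry_on_snd
      by (auto simp: prod[of u v] prod[of u' v'] isometry_on_def minus_Linf dist_norm)
  qed
qed

end

section \<open>Behaviour of the inverse on corners\<close>

lemma eq_minus_self:
  fixes u :: "'a::real_vector"
  shows "u = - u \<longleftrightarrow> u = 0"
  by (metis add.inverse_neutral add_eq_0_iff scaleR_2 scaleR_eq_0_iff zero_neq_numeral)

context linf_bijection
begin

lemma G_minus_corner:
  assumes "norm x = 1" "norm y = 1"
  shows "G (Linf (- x) (- y)) = - G (Linf x y)"
proof -
  have n: "norm (Linf x y) \<le> 1" using assms by simp
  have "F (- G (Linf x y)) = Linf (- x) (- y)"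
    using F_minus[of "G (Linf x y)"] rigid_corner[OF assms] F_G[OF n] norm_G_le_1[OF n]
    by (simp add: uminus_Linf)
  then show ?thesis
    using G_F[of "- G (Linf x y)"] norm_G_le_1[OF n] by simp
qed

text \<open>The first corner is at distance 2 from the antipode of the second. Since
  \<open>G\<close> is expansive and odd on corners, some coordinates of the two preimages have a sum
  of norm at least 2, so they are equal unit vectors.\<close>

lemma G_shared_coordinate:
  assumes n: "norm x = 1" "norm y = 1" "norm x' = 1" "norm y' = 1" and eq: "x = x' \<or> y = y'"
  shows "linf_fst (G (Linf x y)) = linf_fst (G (Linf x' y')) \<and> norm (linf_fst (G (Linf x y))) = 1 \<or>
    linf_snd (G (Linf x y)) = linf_snd (G (Linf x' y')) \<and> norm (linf_snd (G (Linf x y))) = 1"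
proof -
  define z w where "z = G (Linf x y)" and "w = G (Linf x' y')"
  have zw: "norm (linf_fst z) \<le> 1" "norm (linf_snd z) \<le> 1"
    "norm (linf_fst w) \<le> 1" "norm (linf_snd w) \<le> 1"
    using norm_G_le_1[of "Linf x y"] norm_G_le_1[of "Linf x' y'"] n
    by (simp_all add: z_def w_def norm_linf_sum_def)
  have "norm (x + x') = 2 \<or> norm (y + y') = 2"
    using eq n by (auto simp flip: scaleR_2)
  then have "2 \<le> norm (Linf x y - Linf (- x') (- y'))"
    by (auto simp: minus_Linf)
  also have "\<dots> \<le> norm (z - G (Linf (- x') (- y')))"
    unfolding z_def by (intro G_expansive) (simp_all add: n)
  also have "\<dots> = max (norm (linf_fst z + linf_fst w)) (norm (linf_snd z + linf_snd w))"
    using G_minus_corner n by (simp add: w_def norm_linf_sum_def)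
  finally have "2 \<le> norm (linf_fst z + linf_fst w) \<or> 2 \<le> norm (linf_snd z + linf_snd w)"
    by (simp add: le_max_iff_disj)
  then show ?thesis
  proof
    assume far: "2 \<le> norm (linf_fst z + linf_fst w)"
    then have "linf_fst z = linf_fst w"
      using eq_if_norm_add_eq_2[OF rigid_a] zw by blast
    then show ?thesis
      using far zw by (simp add: z_def w_def flip: scaleR_2)
  next
    assume far: "2 \<le> norm (linf_snd z + linf_snd w)"
    then have "linf_snd z = linf_snd w"
      using eq_if_norm_add_eq_2[OF rigid_b] zw by blast
    then show ?thesis
      using far zw by (simp add: z_def w_def flip: scaleR_2)
  qed
qed

definition pp :: "'c \<Rightarrow> 'd \<Rightarrow> 'a" where "pp x y = linf_fst (G (Linf x y))"
definition qq :: "'c \<Rightarrow> 'd \<Rightarrow> 'b" where "qq x y = linf_snd (G (Linf x y))"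

lemma pp_minus: "norm x = 1 \<Longrightarrow> norm y = 1 \<Longrightarrow> pp (- x) (- y) = - pp x y"
  and qq_minus: "norm x = 1 \<Longrightarrow> norm y = 1 \<Longrightarrow> qq (- x) (- y) = - qq x y"
  by (simp_all add: pp_def qq_def G_minus_corner)

lemma corner_share:
  assumes "norm x = 1" "norm y = 1" "norm x' = 1" "norm y' = 1" "x = x' \<or> y = y'"
  shows "pp x y = pp x' y' \<and> norm (pp x y) = 1 \<or> qq x y = qq x' y' \<and> norm (qq x y) = 1"
  using G_shared_coordinate[OF assms] by (simp add: pp_def qq_def)

text \<open>Compare the corner \<open>(x, - y)\<close> with its neighbours \<open>(x, y)\<close> and \<open>(- x, - y)\<close>.\<close>

lemma corner_cases:
  assumes "norm x = 1" "norm y = 1"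
  shows "norm (pp x y) = 1 \<and> norm (qq x y) = 1 \<and>
    (pp x (- y) = pp x y \<and> qq x (- y) = - qq x y \<or> pp x (- y) = - pp x y \<and> qq x (- y) = qq x y)"
proof -
  have 1: "pp x y = pp x (- y) \<and> norm (pp x y) = 1 \<or> qq x y = qq x (- y) \<and> norm (qq x y) = 1"
    using corner_share[of x y x "- y"] assms by simp
  have 2: "- pp x y = pp x (- y) \<and> norm (pp x y) = 1 \<or> - qq x y = qq x (- y) \<and> norm (qq x y) = 1"
    using corner_share[of "- x" "- y" x "- y"] pp_minus[of x y] qq_minus[of x y] assms by simp
  have "pp x y \<noteq> - pp x y" if "norm (pp x y) = 1"
    using that by (auto simp: eq_minus_self)
  moreover have "qq x y \<noteq> - qq x y" if "norm (qq x y) = 1"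
    using that by (auto simp: eq_minus_self)
  ultimately show ?thesis using 1 2 by metis
qed

text \<open>If the value changed, \<open>(x, y')\<close> would share its second coordinate under
  \<open>G\<close> with both \<open>(x, y)\<close> and \<open>(x, - y)\<close>, where
  \<open>qq\<close> takes opposite values.\<close>

lemma pp_const:
  assumes n: "norm x = 1" "norm y = 1" "norm y' = 1" and T: "pp x (- y) = pp x y"
  shows "pp x y' = pp x y"
proof (rule ccontr)
  assume neq: "pp x y' \<noteq> pp x y"
  have "norm (qq x y) = 1" "norm (pp x y) = 1" "qq x (- y) = - qq x y"
    using corner_cases[OF n(1,2)] T by (auto simp: eq_minus_self)
  moreover have "qq x y' = qq x y" "qq x y' = qq x (- y)"
    using corner_share[of x y' x y] corner_share[of x y' x "- y"] n neq T by auto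
  ultimately show False
    by (metis eq_minus_self norm_zero zero_neq_one)
qed

text \<open>Same argument with the neighbours \<open>(x, y)\<close> and \<open>(- x, y)\<close>,
  between which \<open>pp\<close> changes sign.\<close>

lemma qq_const:
  assumes n: "norm x = 1" "norm y = 1" "norm x' = 1" and T: "pp x (- y) = pp x y"
  shows "qq x' y = qq x y"
proof (rule ccontr)
  assume neq: "qq x' y \<noteq> qq x y"
  have c: "norm (qq x y) = 1" "norm (pp x y) = 1" "qq x (- y) = - qq x y"
    using corner_cases[OF n(1,2)] T by (auto simp: eq_minus_self)
  then have m: "qq (- x) y = qq x y" "pp (- x) y = - pp x y"
    using pp_minus[of x "- y"] qq_minus[of x "- y"] n T by auto
  moreover have "pp x' y = pp x y" "pp x' y = pp (- x) y"
    using corner_share[of x' y x y] corner_share[of x' y "- x" y] n neq m by auto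
  ultimately show False
    using c by (metis eq_minus_self norm_zero zero_neq_one)
qed

text \<open>The sign pattern at one corner propagates: constancy of \<open>qq\<close> in its first
  argument carries it to every \<open>(x, y0)\<close>, then constancy of \<open>pp\<close> in its
  second argument carries it to every \<open>(x0, y)\<close>.\<close>

lemma linf_crossI:
  assumes n: "norm x0 = 1" "norm y0 = 1" and T: "pp x0 (- y0) = pp x0 y0"
  shows "linf_cross F (\<lambda>x. pp x y0) (\<lambda>y. qq x0 y)"
proof -
  have p: "pp x y = pp x y0" if xy: "norm x = 1" "norm y = 1" for x y
  proof (rule pp_const)
    have "qq x y0 = qq x0 y0" "qq (- x) y0 = qq x0 y0"
      using qq_const[OF n _ T] xy by auto
    then have "qq x (- y0) = - qq x y0"
      using qq_minus[of "- x" y0] xy n by simp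
    then show "pp x (- y0) = pp x y0"
      using corner_cases[of x y0] xy n eq_minus_self[of "qq x y0"] by auto
  qed (use n xy in auto)
  have q: "qq x y = qq x0 y" if xy: "norm x = 1" "norm y = 1" for x y
    using qq_const[of x0 y x] p[of x0 y] p[of x0 "- y"] xy n by simp
  show ?thesis
  proof unfold_locales
    fix x :: 'c and y :: 'd assume xy: "norm x = 1" "norm y = 1"
    have "Linf (pp x y) (qq x y) = G (Linf x y)"
      by (simp add: pp_def qq_def)
    then show "F (Linf (pp x y0) (qq x0 y)) = Linf x y"
      using p[OF xy] q[OF xy] F_G[of "Linf x y"] xy by simp
  qed (use corner_cases n in auto)
qed

lemma linf_bijection_swap_comp: "linf_bijection (swap \<circ> F)"
proof -
  interpret sw: ball_bijection "swap \<circ> F"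
    by (rule ball_bijection_swap_comp) (rule ball_bijection_axioms)
  show ?thesis
    by unfold_locales (simp_all add: rigid_a rigid_b rigid_c rigid_d ex_c ex_d)
qed

theorem isometry_linf: "isometry_on (cball 0 1) F"
proof -
  obtain x :: 'c and y :: 'd where n: "norm x = 1" "norm y = 1"
    using ex_c ex_d by blast
  show ?thesis
  proof (cases "pp x (- y) = pp x y")
    case True
    then interpret linf_cross F "\<lambda>x. pp x y" "\<lambda>y. qq x y"
      using linf_crossI n by blast
    show ?thesis by (rule isometry_F)
  next
    case False
    interpret sw: linf_bijection "swap \<circ> F" by (rule linf_bijection_swap_comp)
    have G: "sw.G (Linf y' x') = G (Linf x' y')" if "norm x' = 1" "norm y' = 1" for x' y'
      using sw.G_F[of "G (Linf x' y')"] F_G[of "Linf x' y'"] norm_G_le_1[of "Linf x' y'"] that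
      by simp
    \<comment> \<open>In this case \<open>pp\<close> changes sign with \<open>y\<close>, so by
      oddness it ignores the sign of \<open>x\<close>; this is the condition of
      \<open>linf_crossI\<close> for \<open>swap \<circ> F\<close>.\<close>
    have "pp (- x) y = pp x y"
      using corner_cases[OF n] pp_minus[of x "- y"] False n by auto
    then have "sw.pp y (- x) = sw.pp y x"
      using G[of x y] G[of "- x" y] n by (simp add: sw.pp_def pp_def)
    then interpret cr: linf_cross "swap \<circ> F" "\<lambda>y. sw.pp y x" "\<lambda>x. sw.qq y x"
      using sw.linf_crossI n by blast
    show ?thesis using cr.isometry_F by simp
  qed
qed

end

theorem theorem4p1:
  assumes "strictly_convex TYPE('a::banach)"
    and "strictly_convex TYPE('b::banach)"
  shows "plastic (cball (0 :: ('a, 'b) linf_sum) 1)"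
  unfolding plastic_def
proof (intro allI impI)
  fix F :: "('a, 'b) linf_sum \<Rightarrow> ('a, 'b) linf_sum"
  assume "bij_betw F (cball 0 1) (cball 0 1)" "non_expansive_on (cball 0 1) F"
  then interpret ball_bijection F by unfold_locales
  have rigid_a: "rigid e" if "norm e = 1" for e :: 'a
    using strictly_convex_rigid assms(1) that by blast
  have rigid_b: "rigid e" if "norm e = 1" for e :: 'b
    using strictly_convex_rigid assms(2) that by blast
  show "isometry_on (cball 0 1) F"
  proof (cases "(\<exists>x::'a. norm x = 1) \<and> (\<exists>y::'b. norm y = 1)")
    case True
    then interpret linf_bijection F
      by unfold_locales (use rigid_a rigid_b in auto)
    show ?thesis by (rule isometry_linf)
  next
    case False
    have "x = 0" if "\<nexists>x::'a. norm x = 1" for x :: 'a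
      using that norm_sgn[of x] by metis
    moreover have "y = 0" if "\<nexists>y::'b. norm y = 1" for y :: 'b
      using that norm_sgn[of y] by metis
    ultimately have trivial: "(\<forall>x::'a. x = 0) \<or> (\<forall>y::'b. y = 0)"
      using False by blast
    show ?thesis
    proof (rule isometry_if_sphere_rigid)
      fix e :: "('a, 'b) linf_sum" assume e: "norm e = 1"
      obtain x y where xy: "e = Linf x y" by (cases e)
      \<comment> \<open>The coordinate in the nontrivial factor carries the whole norm 1.\<close>
      have "rigid x \<and> rigid y"
        using trivial
      proof
        assume "\<forall>x::'a. x = 0"
        then have "rigid x" "x = 0" by (blast intro: rigid_if_trivial)+
        then show ?thesis using e xy rigid_b[of y] by simp
      next
        assume "\<forall>y::'b. y = 0"
        then have "rigid y" "y = 0" by (blast intro: rigid_if_trivial)+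
        then show ?thesis using e xy rigid_a[of x] by simp
      qed
      then show "rigid e" unfolding xy by (intro rigid_Linf) auto
    qed
  qed
qed

end
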